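(* Let $\zeta_6$ be a primitive sixth root of unity. For $n\ge 1$, $$G_n(\mathsf{x};1,\zeta_6^{-1},1,\zeta_6)=\sum_{\alpha\vDash n}\mathsf{Mot}_{\ell(\alpha)}\,h_\alpha=\sum_{j=1}^{n}\left(\sum_{k=0}^{n-j}\binom{n-j}{k}\mathsf{Mot}_{n-k}\right)F_{n,j-1},$$ where the first sum is over compositions $\alpha$ of $n$ and $\ell(\alpha)$ is the number of parts of $\alpha$.
   Context: A (plane binary) tree is a rooted tree in which every node has at most one left child and at most one right child (it may have only one of the two), and no other children. A labeled tree is a tree whose nodes are labeled with positive integers, repetitions allowed; $\mathcal{T}^{\ell}_n$ is the set of labeled trees on $n$ nodes. Write $v^\ell$ for the label of $v$. If $v$ is the left child of $w$, the edge is a left ascent if $v^\ell\le w^\ell$ and a left descent otherwise. If $w$ is the right child of $v$, the edge is a right ascent if $v^\ell\le w^\ell$ and a right descent otherwise. $\mathrm{lasc},\mathrm{ldes},\mathrm{rasc},\mathrm{rdes}$ count these edges. With $\mathsf{x}^T=\prod_{v\in T}x_{v^\ell}$, $$G_n(\mathsf{x};\bar\lambda,\lambda,\bar\rho,\rho)=\sum_{T\in\mathcal{T}^\ell_n}\bar\lambda^{\mathrm{lasc}(T)}\lambda^{\mathrm{ldes}(T)}\bar\rho^{\,\mathrm{rasc}(T)}\rho^{\,\mathrm{rdes}(T)}\,\mathsf{x}^T.$$ $\mathsf{Mot}_n$ ($n\ge1$) is the Motzkin number, indexed so that it is the number of unlabeled plane binary trees on $n$ nodes in which every node having a right child also has a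 left child; thus $\sum_{n\ge1}\mathsf{Mot}_nx^n=x+x^2+2x^3+4x^4+\cdots$. For $\alpha=(\alpha_1,\dots,\alpha_k)$, $h_\alpha=h_{\alpha_1}\cdots h_{\alpha_k}$ is a product of complete homogeneous symmetric functions. For a composition $\alpha\vDash n$ let $\mathrm{set}(\alpha)=\{\alpha_1,\alpha_1+\alpha_2,\dots,\alpha_1+\cdots+\alpha_{k-1}\}$; the ribbon Schur function is $r_\alpha=\sum_w x_{w_1}\cdots x_{w_n}$ over words $w$ of $n$ positive integers with $\{i:w_i>w_{i+1}\}=\mathrm{set}(\alpha)$. For $0\le k\le n-1$, $F_{n,k}=\sum_{\alpha\vDash n,\ \ell(\alpha)=k+1}r_\alpha$ (the Frobenius characteristic of a Foulkes character). *)

theory Defs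
  imports Complex_Main "HOL-Library.Tree_Multiset"
begin

section \<open>Formal power series in infinitely many variables\<close>

text \<open>
  A monomial in the variables \<open>x\<^sub>i\<close> is the multiset of the indices of its variables, and a
  series is its family of coefficients. The index type is \<^typ>\<open>nat\<close>; the variable with
  index 0 does not occur in any of the series below, whose variables are
  \<open>x\<^sub>1, x\<^sub>2, \<dots>\<close>.
\<close>

typedef 'a mseries = "UNIV :: (nat multiset \<Rightarrow> 'a) set"
  morphisms mcoeff Abs_mseries by simp

setup_lifting type_definition_mseries

lemma mseries_eqI: "(\<And>M. mcoeff f M = mcoeff g M) \<Longrightarrow> f = g"
  by transfer auto

lemma finite_splits [simp]: "finite {(A, B). A + B = (M :: 'b multiset)}"
proof -
  have "A \<in> mset ` {xs. set xs \<subseteq> set_mset M \<and> length xs \<le> size M}" if "A \<subseteq># M" for A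
  proof -
    obtain xs where "mset xs = A" using ex_mset by blast
    with that set_mset_mono [of A M] size_mset_mono [of A M] show ?thesis
      by (intro image_eqI [of _ _ xs]) auto
  qed
  then have "{(A, B). A + B = M} \<subseteq>
      (let S = mset ` {xs. set xs \<subseteq> set_mset M \<and> length xs \<le> size M} in S \<times> S)"
    unfolding Let_def by auto
  moreover have "finite \<dots>"
    unfolding Let_def by (intro finite_cartesian_product finite_imageI finite_lists_length_le) auto
  ultimately show ?thesis by (rule finite_subset)
qed

instantiation mseries :: (comm_ring_1) comm_ring_1
begin

lift_definition zero_mseries :: "'a mseries" is "\<lambda>_. 0" .
lift_definition one_mseries :: "'a mseries" is "\<lambda>M. if M = {#} then 1 else 0" .
lift_definition plus_mseries :: "'a mseries \<Rightarrow> 'a mseries \<Rightarrow> 'a mseries"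
  is "\<lambda>f g M. f M + g M" .
lift_definition minus_mseries :: "'a mseries \<Rightarrow> 'a mseries \<Rightarrow> 'a mseries"
  is "\<lambda>f g M. f M - g M" .
lift_definition uminus_mseries :: "'a mseries \<Rightarrow> 'a mseries" is "\<lambda>f M. - f M" .
lift_definition times_mseries :: "'a mseries \<Rightarrow> 'a mseries \<Rightarrow> 'a mseries"
  is "\<lambda>f g M. \<Sum>(A, B) | A + B = M. f A * g B" .

instance
proof
  fix f g h :: "'a mseries"
  show "f * g * h = f * (g * h)"
  proof (transfer, rule ext)
    fix f g h :: "nat multiset \<Rightarrow> 'a" and M
    let ?S = "{(A, B :: nat multiset). A + B = M}"
    have "(\<Sum>(A, B)\<in>?S. (\<Sum>(C, D) | C + D = A. f C * g D) * h B)
        = (\<Sum>p\<in>?S. \<Sum>q\<in>{(C, D). C + D = fst p}. f (fst q) * g (snd q) * h (snd p))"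
      by (intro sum.cong) (auto simp: sum_distrib_right case_prod_beta)
    also have "\<dots> = (\<Sum>(p, q)\<in>Sigma ?S (\<lambda>p. {(C, D). C + D = fst p}).
        f (fst q) * g (snd q) * h (snd p))"
      by (rule sum.Sigma) auto
    also have "\<dots> = (\<Sum>(p, q)\<in>Sigma ?S (\<lambda>p. {(C, D). C + D = snd p}).
        f (fst p) * (g (fst q) * h (snd q)))"
      by (rule sum.reindex_bij_witness
          [of _ "\<lambda>(p, q). ((fst p + fst q, snd q), (fst p, fst q))"
                "\<lambda>(p, q). ((fst q, snd q + snd p), (snd q, snd p))"])
         (auto simp: ac_simps)
    also have "\<dots> = (\<Sum>p\<in>?S. \<Sum>q\<in>{(C, D). C + D = snd p}. f (fst p) * (g (fst q) * h (snd q)))"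
      by (rule sum.Sigma [symmetric]) auto
    also have "\<dots> = (\<Sum>(A, B)\<in>?S. f A * (\<Sum>(C, D) | C + D = B. g C * h D))"
      by (intro sum.cong) (auto simp: sum_distrib_left case_prod_beta)
    finally show "(\<Sum>(A, B)\<in>?S. (\<Sum>(C, D) | C + D = A. f C * g D) * h B)
      = (\<Sum>(A, B)\<in>?S. f A * (\<Sum>(C, D) | C + D = B. g C * h D))" .
  qed
  show "f * g = g * f"
    by (transfer, rule ext,
        rule sum.reindex_bij_witness [of _ prod.swap prod.swap]) (auto simp: ac_simps)
  show "1 * f = f"
  proof (transfer, rule ext)
    fix f :: "nat multiset \<Rightarrow> 'a" and M
    have "(\<Sum>(A, B) | A + B = M. (if A = {#} then 1 else 0) * f B)
        = (\<Sum>(A, B)\<in>{({#} :: nat multiset, M)}. (if A = {#} then 1 else 0) * f B)"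
      by (rule sum.mono_neutral_right) (auto split: if_splits)
    then show "(\<Sum>(A, B) | A + B = M. (if A = {#} then 1 else 0) * f B) = f M"
      by simp
  qed
  show "(f + g) * h = f * h + g * h"
    by (transfer, rule ext) (simp add: sum.distrib [symmetric] case_prod_beta algebra_simps)
  show "(0 :: 'a mseries) \<noteq> 1"
    by transfer (metis zero_neq_one)
qed (transfer; simp add: fun_eq_iff algebra_simps)+

end

text \<open>
  The series \<open>\<Sum>t\<in>A. w t \<cdot> x\<^sup>(mon t)\<close> over a possibly infinite family \<open>A\<close>. It is
  meaningful when every monomial is \<open>mon t\<close> for only finitely many \<open>t \<in> A\<close>, which is the case in
  all uses below.
\<close>

lift_definition formal_sum :: "'t set \<Rightarrow> ('t \<Rightarrow> 'a) \<Rightarrow> ('t \<Rightarrow> nat multiset) \<Rightarrow> 'a::comm_ring_1 mseries"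
  is "\<lambda>A w mon M. \<Sum>t | t \<in> A \<and> mon t = M. w t" .


section \<open>Labeled plane binary trees\<close>

text \<open>
  In \<^typ>\<open>'a tree\<close> the nodes are the \<^const>\<open>Node\<close>s, a \<^const>\<open>Leaf\<close> stands for an absent child,
  and \<^const>\<open>size\<close> counts the nodes.
\<close>

definition labeled_trees :: "nat \<Rightarrow> nat tree set" where
  "labeled_trees n = {T. size T = n \<and> (\<forall>a\<in>set_tree T. 0 < a)}"

text \<open>
  The parent-to-child edges of a tree, as pairs (label of parent, label of child).
\<close>

fun root_label :: "'a tree \<Rightarrow> 'a list" where
  "root_label Leaf = []"
| "root_label (Node l a r) = [a]"

fun left_edges :: "'a tree \<Rightarrow> ('a \<times> 'a) list" where
  "left_edges Leaf = []"
| "left_edges (Node l a r) = map (Pair a) (root_label l) @ left_edges l @ left_edges r"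

fun right_edges :: "'a tree \<Rightarrow> ('a \<times> 'a) list" where
  "right_edges Leaf = []"
| "right_edges (Node l a r) = map (Pair a) (root_label r) @ right_edges l @ right_edges r"

definition lasc :: "nat tree \<Rightarrow> nat" where
  "lasc T = length (filter (\<lambda>(parent, child). child \<le> parent) (left_edges T))"

definition ldes :: "nat tree \<Rightarrow> nat" where
  "ldes T = length (filter (\<lambda>(parent, child). \<not> child \<le> parent) (left_edges T))"

definition rasc :: "nat tree \<Rightarrow> nat" where
  "rasc T = length (filter (\<lambda>(parent, child). parent \<le> child) (right_edges T))"

definition rdes :: "nat tree \<Rightarrow> nat" where
  "rdes T = length (filter (\<lambda>(parent, child). \<not> parent \<le> child) (right_edges T))"

text \<open>
  \<open>G n la ld ra rd\<close> is \<open>G\<^sub>n(x; \<lambda>', \<lambda>, \<rho>', \<rho>)\<close>, where \<open>la\<close> and \<open>ra\<close> are the barred parameters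
  \<open>\<lambda>'\<close> and \<open>\<rho>'\<close> that mark ascents.
\<close>

definition G :: "nat \<Rightarrow> 'a \<Rightarrow> 'a \<Rightarrow> 'a \<Rightarrow> 'a \<Rightarrow> 'a::comm_ring_1 mseries" where
  "G n la ld ra rd =
     formal_sum (labeled_trees n)
       (\<lambda>T. la ^ lasc T * ld ^ ldes T * ra ^ rasc T * rd ^ rdes T) mset_tree"

fun right_needs_left :: "'a tree \<Rightarrow> bool" where
  "right_needs_left Leaf \<longleftrightarrow> True"
| "right_needs_left (Node l a r) \<longleftrightarrow>
     (r \<noteq> Leaf \<longrightarrow> l \<noteq> Leaf) \<and> right_needs_left l \<and> right_needs_left r"

definition Mot :: "nat \<Rightarrow> nat" where
  "Mot n = card {T :: unit tree. size T = n \<and> right_needs_left T}"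


section \<open>Symmetric functions\<close>

definition compositions :: "nat \<Rightarrow> nat list set" where
  "compositions n = {\<alpha>. (\<forall>a\<in>set \<alpha>. 0 < a) \<and> sum_list \<alpha> = n}"

definition comp_set :: "nat list \<Rightarrow> nat set" where
  "comp_set \<alpha> = {sum_list (take i \<alpha>) | i. 1 \<le> i \<and> i < length \<alpha>}"

text \<open>The complete homogeneous symmetric function: the sum of all monomials of degree \<open>k\<close>.\<close>

definition hom_sym :: "nat \<Rightarrow> 'a::comm_ring_1 mseries" where
  "hom_sym k = formal_sum {M. size M = k \<and> (\<forall>i\<in>#M. 0 < i)} (\<lambda>_. 1) (\<lambda>M. M)"

definition hom_sym_comp :: "nat list \<Rightarrow> 'a::comm_ring_1 mseries" where
  "hom_sym_comp \<alpha> = prod_list (map hom_sym \<alpha>)"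

text \<open>Positions in words are counted from 1, as the elements of \<^const>\<open>comp_set\<close> require.\<close>

definition descent_set :: "nat list \<Rightarrow> nat set" where
  "descent_set w = {i. 1 \<le> i \<and> i < length w \<and> w ! (i - 1) > w ! i}"

definition ribbon :: "nat list \<Rightarrow> 'a::comm_ring_1 mseries" where
  "ribbon \<alpha> =
     formal_sum {w. length w = sum_list \<alpha> \<and> (\<forall>a\<in>set w. 0 < a) \<and> descent_set w = comp_set \<alpha>}
       (\<lambda>_. 1) mset"

definition foulkes :: "nat \<Rightarrow> nat \<Rightarrow> 'a::comm_ring_1 mseries" where
  "foulkes n k = (\<Sum>\<alpha> | \<alpha> \<in> compositions n \<and> length \<alpha> = k + 1. ribbon \<alpha>)"


section \<open>Finiteness of the sums and cardinalities above\<close>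

lemma finite_trees_height:
  assumes "finite A"
  shows "finite {T. height T \<le> h \<and> set_tree T \<subseteq> A}"
proof (induction h)
  case 0
  have "{T. height T \<le> 0 \<and> set_tree T \<subseteq> A} \<subseteq> {Leaf}" by auto
  then show ?case by (meson finite.simps finite_subset)
next
  case (Suc h)
  let ?S = "{T. height T \<le> h \<and> set_tree T \<subseteq> A}"
  have "T \<in> insert Leaf ((\<lambda>(l, a, r). Node l a r) ` (?S \<times> A \<times> ?S))"
    if "height T \<le> Suc h" "set_tree T \<subseteq> A" for T
    using that by (cases T) (auto simp: image_iff)
  then have "{T. height T \<le> Suc h \<and> set_tree T \<subseteq> A}
      \<subseteq> insert Leaf ((\<lambda>(l, a, r). Node l a r) ` (?S \<times> A \<times> ?S))" by blast
  then show ?case using Suc assms by (meson finite_SigmaI finite_imageI finite_insert finite_subset)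
qed

lemma finite_trees_size:
  assumes "finite A"
  shows "finite {T. size T = n \<and> set_tree T \<subseteq> A}"
  by (rule finite_subset [OF _ finite_trees_height [OF assms, of n]])
     (use height_le_size_tree in auto)

lemma finite_labeled_trees_mset: "finite {T. T \<in> labeled_trees n \<and> mset_tree T = M}"
  by (rule finite_subset [OF _ finite_trees_size [of "set_mset M" n]])
     (auto simp: labeled_trees_def)

lemma finite_Mot: "finite {T :: unit tree. size T = n \<and> right_needs_left T}"
  by (rule finite_subset [OF _ finite_trees_size [of UNIV n]]) auto

lemma finite_words_mset: "finite {w. P w \<and> mset w = M}"
  by (rule finite_subset [OF _ finite_lists_length_eq [of "set_mset M" "size M"]])
     auto

lemma finite_compositions: "finite (compositions n)"
proof (rule finite_subset [OF _ finite_lists_length_le [of "{..n}" n]])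
  have "length \<alpha> \<le> sum_list \<alpha>" if "\<forall>a\<in>set \<alpha>. 0 < a" for \<alpha> :: "nat list"
    using that by (induction \<alpha>) fastforce+
  then show "compositions n \<subseteq> {xs. set xs \<subseteq> {..n} \<and> length xs \<le> n}"
    by (auto simp: compositions_def intro: member_le_sum_list)
qed auto

end

theory Submission
  imports Defs "HOL-Computational_Algebra.Polynomial"
begin

text \<open>
  Let \<open>g\<close> be the sum of all \<open>G\<^sub>n\<close> and \<open>s\<^sub>i\<close> the part of \<open>g\<close> coming from trees whose root label is at
  most \<open>i\<close>. Removing the root gives \<open>s\<^sub>i - s\<^sub>i\<^sub>-\<^sub>1 = x\<^sub>i L\<^sub>i R\<^sub>i\<^sub>-\<^sub>1\<close>, where \<open>L\<^sub>i\<close> and \<open>R\<^sub>i\<close> are affine in \<open>s\<^sub>i\<close>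
  and account for the left and the right subtree. This discrete Riccati equation is solved by the
  quotient \<open>L\<^sub>i / R\<^sub>i\<close>. With \<open>c = \<zeta>\<^sup>-\<^sup>1\<close>, \<open>d = \<zeta>\<close> and \<open>c + d = c d = 1\<close> one finds
  \<open>c L\<^sub>i + d R\<^sub>i = 1\<close> and \<open>L\<^sub>i R\<^sub>i\<^sub>-\<^sub>1 (1 - x\<^sub>i) = L\<^sub>i\<^sub>-\<^sub>1 R\<^sub>i\<close>, so in the limit
  \<open>(1 + g)\<^sup>2 = (1 + g + g\<^sup>2) H\<close> with \<open>H = \<Sum> h\<^sub>k\<close>. Hence \<open>g = K (1 + g + g\<^sup>2)\<close> for \<open>K = H - 1\<close>, which is
  the functional equation of the Motzkin generating function at \<open>K\<close>.

  For the second identity, \<open>h\<^sub>\<alpha>\<close> enumerates the words whose descent set is contained in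
  \<open>set(\<alpha>)\<close>, and compositions of \<open>n\<close> correspond to subsets of \<open>{1, \<dots>, n - 1}\<close>.
\<close>

section \<open>Coefficients and formal sums\<close>

lemmas mcoeff_simps [simp] =
  zero_mseries.rep_eq one_mseries.rep_eq plus_mseries.rep_eq minus_mseries.rep_eq
  uminus_mseries.rep_eq

lemma mcoeff_sum [simp]: "mcoeff (sum f A) M = (\<Sum>a\<in>A. mcoeff (f a) M)"
  by (induction A rule: infinite_finite_induct) auto

lemma mcoeff_of_nat_times [simp]: "mcoeff (of_nat c * f) M = of_nat c * mcoeff f M"
  by (induction c) (auto simp: algebra_simps)

text \<open>The splits \<open>M = A + B\<close> involve submultisets of \<open>M\<close> only. The
  passage to infinitely many variables rests on this.\<close>

lemma mcoeff_times_cong: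
  assumes "\<And>A. A \<subseteq># M \<Longrightarrow> mcoeff f A = mcoeff f' A"
    and "\<And>A. A \<subseteq># M \<Longrightarrow> mcoeff g A = mcoeff g' A"
  shows "mcoeff (f * g) M = mcoeff (f' * g') M"
  unfolding times_mseries.rep_eq by (rule sum.cong) (auto simp: assms)

lemma mcoeff_times_empty: "mcoeff (f * g) {#} = mcoeff f {#} * mcoeff g {#}"
proof -
  have "{(A, B). A + B = ({#} :: nat multiset)} = {({#}, {#})}" by auto
  then show ?thesis by (simp add: times_mseries.rep_eq)
qed

text \<open>Induction on \<open>size M\<close>: in the coefficient of \<open>u * f\<close> at
  \<open>M\<close>, every term but \<open>mcoeff u {#} * mcoeff f M\<close> contains a coefficient
  of \<open>f\<close> of smaller degree, which vanishes. The bound \<open>n\<close> makes this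
  usable modulo high degrees.\<close>

lemma mcoeff_eq_0_if_unit_times:
  assumes u: "mcoeff u {#} = 1"
    and uf: "\<And>M. size M \<le> n \<Longrightarrow> mcoeff (u * f) M = 0"
    and M: "size M \<le> n"
  shows "mcoeff f M = 0"
  using M
proof (induction "size M" arbitrary: M rule: less_induct)
  case less
  have "0 = (\<Sum>(A, B) | A + B = M. mcoeff u A * mcoeff f B)"
    using uf [OF less.prems] by (simp add: times_mseries.rep_eq)
  also have "\<dots> = (\<Sum>(A, B)\<in>{({#}, M)}. mcoeff u A * mcoeff f B)"
  proof (rule sum.mono_neutral_right)
    have "mcoeff u A * mcoeff f B = 0" if AB: "A + B = M" and "(A, B) \<noteq> ({#}, M)" for A B
    proof -
      have "A \<noteq> {#}" using that by auto
      then show ?thesis using less.hyps [of B] less.prems AB by (auto simp: nonempty_has_size)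
    qed
    then show "\<forall>p\<in>{(A, B). A + B = M} - {({#}, M)}. (case p of (A, B) \<Rightarrow> mcoeff u A * mcoeff f B) = 0"
      by auto
  qed auto
  finally show ?case using u by simp
qed

lemma unit_times_cancel:
  assumes "mcoeff u {#} = 1" and "u * f = u * g"
  shows "f = g"
proof (rule mseries_eqI)
  fix M
  have "mcoeff (f - g) M = 0"
    by (rule mcoeff_eq_0_if_unit_times [where u = u and n = "size M"])
       (use assms in \<open>auto simp: right_diff_distrib\<close>)
  then show "mcoeff f M = mcoeff g M" by simp
qed

text \<open>Each factor \<open>f\<close> raises the degree by at least one. The arbitrary cofactor
  \<open>g\<close> covers remainders known only as multiples of \<open>f ^ k\<close>.\<close>

lemma mcoeff_power_eq_0:
  assumes "mcoeff f {#} = 0" and "size M < k"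
  shows "mcoeff (f ^ k * g) M = 0"
  using assms(2)
proof (induction k arbitrary: M)
  case (Suc k)
  have "mcoeff f A * mcoeff (f ^ k * g) B = 0" if "A + B = M" for A B
    using that Suc.prems Suc.IH [of B] assms(1) by (cases "A = {#}") (auto simp: nonempty_has_size)
  then show ?case
    by (simp only: power_Suc mult.assoc times_mseries.rep_eq [of f])
       (auto intro: sum.neutral)
qed simp

text \<open>A monomial as a sum over a one-element family, so that the product rule for families
  covers it; \<open>mmonom c {#}\<close> serves as the scalar \<open>c\<close>.\<close>

definition mmonom :: "'a::comm_ring_1 \<Rightarrow> nat multiset \<Rightarrow> 'a mseries" where
  "mmonom c A = formal_sum {()} (\<lambda>_. c) (\<lambda>_. A)"

lemma mcoeff_mmonom [simp]: "mcoeff (mmonom c A) M = (if A = M then c else 0)"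
  by (simp add: mmonom_def formal_sum.rep_eq)

lemma mcoeff_mmonom_times [simp]:
  "mcoeff (mmonom c A * f) M = (if A \<subseteq># M then c * mcoeff f (M - A) else 0)"
proof -
  have "mcoeff (mmonom c A * f) M = 
      (\<Sum>(P, Q)\<in>(if A \<subseteq># M then {(A, M - A)} else {}). mcoeff (mmonom c A) P * mcoeff f Q)"
    unfolding times_mseries.rep_eq by (rule sum.mono_neutral_right) (auto split: if_splits)
  then show ?thesis by simp
qed

lemma mmonom_0_hom:
  "mmonom 1 {#} = 1" "mmonom (a + b) {#} = mmonom a {#} + mmonom b {#}"
  "mmonom (a * b) {#} = mmonom a {#} * mmonom b {#}"
  by (auto intro!: mseries_eqI)

text \<open>A \<open>sum\<close> over an infinite set is 0 by convention, so formal sums can safely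
  be split and multiplied only when each monomial has finitely many preimages.\<close>

definition finite_fibres :: "'t set \<Rightarrow> ('t \<Rightarrow> 'm) \<Rightarrow> bool" where
  "finite_fibres A m \<longleftrightarrow> (\<forall>M. finite {t. t \<in> A \<and> m t = M})"

section \<open>Rules for sums over families\<close>

lemma formal_sum_cong:
  "A = B \<Longrightarrow> (\<And>t. t \<in> B \<Longrightarrow> w t = v t) \<Longrightarrow> (\<And>t. t \<in> B \<Longrightarrow> m t = m' t) \<Longrightarrow>
    formal_sum A w m = formal_sum B v m'"
  by (rule mseries_eqI) (simp add: formal_sum.rep_eq, rule sum.cong, auto)

lemma formal_sum_reindex:
  assumes "bij_betw f A B"
  shows "formal_sum B w m = formal_sum A (\<lambda>t. w (f t)) (\<lambda>t. m (f t))"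
proof (rule mseries_eqI)
  fix M
  have "bij_betw f {t. t \<in> A \<and> m (f t) = M} {t. t \<in> B \<and> m t = M}"
    using assms unfolding bij_betw_def inj_on_def by auto
  then show "mcoeff (formal_sum B w m) M = mcoeff (formal_sum A (\<lambda>t. w (f t)) (\<lambda>t. m (f t))) M"
    unfolding formal_sum.rep_eq by (metis (mono_tags, lifting) sum.reindex_bij_betw)
qed

lemma formal_sum_Un:
  assumes "finite_fibres (A \<union> B) m" and "A \<inter> B = {}"
  shows "formal_sum (A \<union> B) w m = formal_sum A w m + formal_sum B w m"
proof (rule mseries_eqI)
  fix M
  have "{t. t \<in> A \<union> B \<and> m t = M} = {t. t \<in> A \<and> m t = M} \<union> {t. t \<in> B \<and> m t = M}" by auto
  moreover have "finite {t. t \<in> A \<union> B \<and> m t = M}"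
    using assms(1) by (simp add: finite_fibres_def)
  ultimately show "mcoeff (formal_sum (A \<union> B) w m) M = mcoeff (formal_sum A w m + formal_sum B w m) M"
    using assms(2) by (simp add: formal_sum.rep_eq) (subst sum.union_disjoint; auto)
qed

lemma formal_sum_cmult:
  "formal_sum A (\<lambda>t. c * w t) m = mmonom c {#} * formal_sum A w m"
  by (auto intro!: mseries_eqI simp: formal_sum.rep_eq sum_distrib_left)

text \<open>The pairs with total monomial \<open>M\<close> fall into classes according to the split
  of \<open>M\<close> into \<open>m s\<close> and \<open>m' t\<close>; summing class by class is the
  convolution.\<close>

lemma formal_sum_times:
  assumes "finite_fibres A m" and "finite_fibres B m'"
  shows "formal_sum A w m * formal_sum B v m' =
      formal_sum (A \<times> B) (\<lambda>(s, t). w s * v t) (\<lambda>(s, t). m s + m' t)"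
proof (rule mseries_eqI)
  fix M :: "nat multiset"
  let ?S = "{(P, Q :: nat multiset). P + Q = M}"
  let ?F = "\<lambda>P. {s. s \<in> A \<and> m s = P}" and ?F' = "\<lambda>Q. {t. t \<in> B \<and> m' t = Q}"
  have fin: "finite (?F P)" "finite (?F' P)" for P
    using assms by (auto simp: finite_fibres_def)
  have "mcoeff (formal_sum A w m * formal_sum B v m') M
      = (\<Sum>p\<in>?S. \<Sum>q\<in>?F (fst p) \<times> ?F' (snd p). w (fst q) * v (snd q))"
    unfolding times_mseries.rep_eq formal_sum.rep_eq
    by (intro sum.cong) (auto simp: sum_product sum.cartesian_product case_prod_beta)
  also have "\<dots> = (\<Sum>(p, q)\<in>Sigma ?S (\<lambda>p. ?F (fst p) \<times> ?F' (snd p)). w (fst q) * v (snd q))"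
    by (rule sum.Sigma) (auto simp: fin)
  also have "\<dots> = (\<Sum>q | q \<in> A \<times> B \<and> (case q of (s, t) \<Rightarrow> m s + m' t) = M.
      case q of (s, t) \<Rightarrow> w s * v t)"
    by (rule sum.reindex_bij_witness [of _ "\<lambda>(s, t). ((m s, m' t), (s, t))" snd]) auto
  finally show "mcoeff (formal_sum A w m * formal_sum B v m') M =
      mcoeff (formal_sum (A \<times> B) (\<lambda>(s, t). w s * v t) (\<lambda>(s, t). m s + m' t)) M"
    by (simp add: formal_sum.rep_eq)
qed

section \<open>Trees by root label\<close>

definition tree_wt :: "'a::comm_ring_1 \<Rightarrow> 'a \<Rightarrow> 'a \<Rightarrow> 'a \<Rightarrow> nat tree \<Rightarrow> 'a" where
  "tree_wt la ld ra rd T = la ^ lasc T * ld ^ ldes T * ra ^ rasc T * rd ^ rdes T"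

definition left_wt :: "'a::comm_ring_1 \<Rightarrow> 'a \<Rightarrow> nat \<Rightarrow> nat tree \<Rightarrow> 'a" where
  "left_wt la ld a l = (case l of Leaf \<Rightarrow> 1 | Node _ b _ \<Rightarrow> if b \<le> a then la else ld)"

definition right_wt :: "'a::comm_ring_1 \<Rightarrow> 'a \<Rightarrow> nat \<Rightarrow> nat tree \<Rightarrow> 'a" where
  "right_wt ra rd a r = (case r of Leaf \<Rightarrow> 1 | Node _ b _ \<Rightarrow> if a \<le> b then ra else rd)"

lemma tree_wt_Leaf: "tree_wt la ld ra rd Leaf = 1"
  by (simp add: tree_wt_def lasc_def ldes_def rasc_def rdes_def)

lemma tree_wt_Node:
  "tree_wt la ld ra rd (Node l a r) =
     (left_wt la ld a l * tree_wt la ld ra rd l) * (right_wt ra rd a r * tree_wt la ld ra rd r)"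
  by (cases l; cases r)
     (simp_all add: tree_wt_def left_wt_def right_wt_def lasc_def ldes_def rasc_def rdes_def
       power_add algebra_simps)

definition rooted_trees :: "nat set \<Rightarrow> nat tree set" where
  "rooted_trees I = {T. (\<forall>a\<in>set_tree T. 0 < a) \<and> (\<exists>l a r. T = Node l a r \<and> a \<in> I)}"

lemma finite_fibres_mset_tree: "finite_fibres A mset_tree"
  unfolding finite_fibres_def
proof
  fix M
  have "{T. T \<in> A \<and> mset_tree T = M} \<subseteq> {T. size T = size M \<and> set_tree T \<subseteq> set_mset M}" by auto
  then show "finite {T. T \<in> A \<and> mset_tree T = M}"
    by (rule finite_subset) (intro finite_trees_size finite_set_mset)
qed

definition tree_gf ::
    "'a::comm_ring_1 \<Rightarrow> 'a \<Rightarrow> 'a \<Rightarrow> 'a \<Rightarrow> nat set \<Rightarrow> 'a mseries" where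
  "tree_gf la ld ra rd I = formal_sum (rooted_trees I) (tree_wt la ld ra rd) mset_tree"

lemma tree_gf_Un:
  assumes "I \<inter> J = {}"
  shows "tree_gf la ld ra rd (I \<union> J) = tree_gf la ld ra rd I + tree_gf la ld ra rd J"
proof -
  have "rooted_trees (I \<union> J) = rooted_trees I \<union> rooted_trees J"
    by (auto simp: rooted_trees_def)
  moreover have "rooted_trees I \<inter> rooted_trees J = {}"
    using assms by (auto simp: rooted_trees_def)
  ultimately show ?thesis
    by (simp add: tree_gf_def formal_sum_Un finite_fibres_mset_tree)
qed

text \<open>The root label is one of the labels of the tree, so only labels occurring in
  \<open>M\<close> matter.\<close>

lemma mcoeff_tree_gf_cong:
  assumes "I \<inter> set_mset M = J \<inter> set_mset M"
  shows "mcoeff (tree_gf la ld ra rd I) M = mcoeff (tree_gf la ld ra rd J) M"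
proof -
  have "{T. T \<in> rooted_trees I \<and> mset_tree T = M} = {T. T \<in> rooted_trees J \<and> mset_tree T = M}"
    using assms by (auto simp: rooted_trees_def)
  then show ?thesis by (simp add: tree_gf_def formal_sum.rep_eq)
qed

lemma tree_gf_0: "tree_gf la ld ra rd {0} = 0"
  by (rule mseries_eqI) (auto simp: tree_gf_def formal_sum.rep_eq rooted_trees_def intro!: sum.neutral)

lemma mcoeff_tree_gf_empty: "mcoeff (tree_gf la ld ra rd I) {#} = 0"
  by (auto simp: tree_gf_def formal_sum.rep_eq rooted_trees_def intro!: sum.neutral)

text \<open>A subtree is empty or has its root label in \<open>I\<close> or in \<open>J\<close>, and
  the edge factor \<open>f\<close> is constant on each of these classes.\<close>

lemma formal_sum_child:
  assumes "I \<inter> J = {}" and "I \<union> J = UNIV"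
    and "f Leaf = 1"
    and "\<And>l a r. a \<in> I \<Longrightarrow> f (Node l a r) = c" and "\<And>l a r. a \<in> J \<Longrightarrow> f (Node l a r) = d"
  shows "formal_sum {T. \<forall>a\<in>set_tree T. 0 < a} (\<lambda>T. f T * tree_wt la ld ra rd T) mset_tree =
    1 + mmonom c {#} * tree_gf la ld ra rd I + mmonom d {#} * tree_gf la ld ra rd J"
    (is "formal_sum _ ?w _ = _")
proof -
  have "T \<in> {Leaf} \<union> (rooted_trees I \<union> rooted_trees J)" if "\<forall>a\<in>set_tree T. 0 < a" for T
    using that assms(2) by (cases T) (auto simp: rooted_trees_def)
  then have "{T. \<forall>a\<in>set_tree T. 0 < a} = {Leaf} \<union> (rooted_trees I \<union> rooted_trees J)"
    by (auto simp: rooted_trees_def)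
  moreover have "{Leaf} \<inter> (rooted_trees I \<union> rooted_trees J) = {}"
    and "rooted_trees I \<inter> rooted_trees J = {}"
    using assms(1) by (auto simp: rooted_trees_def)
  ultimately have "formal_sum {T. \<forall>a\<in>set_tree T. 0 < a} ?w mset_tree =
      formal_sum {Leaf} ?w mset_tree + (formal_sum (rooted_trees I) ?w mset_tree +
      formal_sum (rooted_trees J) ?w mset_tree)"
    by (simp only: formal_sum_Un finite_fibres_mset_tree)
  also have "formal_sum {Leaf} ?w mset_tree = 1"
    by (rule mseries_eqI)
       (auto simp: formal_sum.rep_eq tree_wt_Leaf assms(3) if_distrib Collect_conv_if
         cong: if_cong)
  also have "formal_sum (rooted_trees I) ?w mset_tree = mmonom c {#} * tree_gf la ld ra rd I"
    unfolding tree_gf_def formal_sum_cmult [symmetric]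
    by (rule formal_sum_cong) (auto simp: rooted_trees_def assms)
  also have "formal_sum (rooted_trees J) ?w mset_tree = mmonom d {#} * tree_gf la ld ra rd J"
    unfolding tree_gf_def formal_sum_cmult [symmetric]
    by (rule formal_sum_cong) (auto simp: rooted_trees_def assms)
  finally show ?thesis by (simp add: add.assoc)
qed

text \<open>A tree with root label \<open>i\<close> is a free pair of subtrees, and the edges at the
  root are classified by comparing the child labels with \<open>i\<close>. A tie is an ascent on
  both sides, so \<open>i\<close> lies in both \<open>{..i}\<close> and
  \<open>{i..}\<close>.\<close>

lemma tree_gf_root:
  assumes "i > 0"
  shows "tree_gf la ld ra rd {i} = mmonom 1 {#i#} *
    ((1 + mmonom la {#} * tree_gf la ld ra rd {..i} + mmonom ld {#} * tree_gf la ld ra rd {i<..}) *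
     (1 + mmonom ra {#} * tree_gf la ld ra rd {i..} + mmonom rd {#} * tree_gf la ld ra rd {..<i}))"
proof -
  let ?pos = "{T :: nat tree. \<forall>a\<in>set_tree T. 0 < a}"
  let ?wt = "tree_wt la ld ra rd"
  let ?L = "\<lambda>T. left_wt la ld i T * ?wt T" and ?R = "\<lambda>T. right_wt ra rd i T * ?wt T"
  have fin: "finite_fibres (?pos \<times> ?pos) (\<lambda>(l, r). mset_tree l + mset_tree r)"
    unfolding finite_fibres_def
  proof
    fix M :: "nat multiset"
    let ?S = "{T. height T \<le> size M \<and> set_tree T \<subseteq> set_mset M}"
    have "height l \<le> size (mset_tree l + mset_tree r)"
      "height r \<le> size (mset_tree l + mset_tree r)" for l r :: "nat tree"
      using height_le_size_tree [of l] height_le_size_tree [of r] by auto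
    then have "{t. t \<in> ?pos \<times> ?pos \<and> (case t of (l, r) \<Rightarrow> mset_tree l + mset_tree r) = M}
        \<subseteq> ?S \<times> ?S" by (auto simp del: size_union)
    then show "finite {t. t \<in> ?pos \<times> ?pos \<and> (case t of (l, r) \<Rightarrow> mset_tree l + mset_tree r) = M}"
      by (rule finite_subset) (intro finite_SigmaI finite_trees_height finite_set_mset)
  qed
  \<comment> \<open>The unit component stands for the root, whose one-element family carries the
    monomial \<open>{#i#}\<close>.\<close>
  have bij: "bij_betw (\<lambda>(u, l, r). Node l i r) ({()} \<times> ?pos \<times> ?pos) (rooted_trees {i})"
    using assms
    by (intro bij_betw_byWitness [where f' = "\<lambda>T. ((), left T, right T)"])
       (auto simp: rooted_trees_def)
  have "tree_gf la ld ra rd {i} = mmonom 1 {#i#} *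
      (formal_sum ?pos ?L mset_tree * formal_sum ?pos ?R mset_tree)"
    unfolding tree_gf_def mmonom_def formal_sum_reindex [OF bij]
    by (subst formal_sum_times [OF finite_fibres_mset_tree finite_fibres_mset_tree],
        subst formal_sum_times [OF _ fin])
       (auto intro!: formal_sum_cong simp: finite_fibres_def tree_wt_Node)
  also have "formal_sum ?pos ?L mset_tree =
      1 + mmonom la {#} * tree_gf la ld ra rd {..i} + mmonom ld {#} * tree_gf la ld ra rd {i<..}"
    by (rule formal_sum_child) (auto simp: left_wt_def)
  also have "formal_sum ?pos ?R mset_tree =
      1 + mmonom ra {#} * tree_gf la ld ra rd {i..} + mmonom rd {#} * tree_gf la ld ra rd {..<i}"
    by (rule formal_sum_child) (auto simp: right_wt_def)
  finally show ?thesis .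
qed

text \<open>\<open>G n\<close> is the degree \<open>n\<close> part of the series of all nonempty
  trees; \<open>n \<ge> 1\<close> keeps out the empty tree, which has no root label.\<close>

lemma mcoeff_G:
  assumes "n \<ge> 1"
  shows "mcoeff (G n la ld ra rd) M =
    (if size M = n then mcoeff (tree_gf la ld ra rd UNIV) M else 0)"
proof (cases "size M = n")
  case True
  have "T \<in> labeled_trees n \<longleftrightarrow> T \<in> rooted_trees UNIV" if "mset_tree T = M" for T
    using that True assms by (cases T) (auto simp: labeled_trees_def rooted_trees_def)
  then have "{T. T \<in> labeled_trees n \<and> mset_tree T = M} =
      {T. T \<in> rooted_trees UNIV \<and> mset_tree T = M}" by auto
  with True show ?thesis
    by (simp add: G_def tree_gf_def formal_sum.rep_eq tree_wt_def)
next
  case False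
  then show ?thesis
    by (auto simp: G_def formal_sum.rep_eq labeled_trees_def intro!: sum.neutral)
qed

section \<open>The functional equation at the sixth roots of unity\<close>

text \<open>The product of the geometric series \<open>1 / (1 - x_i)\<close> over \<open>i\<close>
  in \<open>I\<close>; for \<open>{0<..}\<close> it is the sum of all \<open>h_k\<close>.\<close>

definition monomials_gf :: "nat set \<Rightarrow> 'a::comm_ring_1 mseries" where
  "monomials_gf I = formal_sum {M. set_mset M \<subseteq> I} (\<lambda>_. 1) (\<lambda>M. M)"

lemma mcoeff_monomials_gf: "mcoeff (monomials_gf I) M = (if set_mset M \<subseteq> I then 1 else 0)"
proof -
  have "{N. N \<in> {M. set_mset M \<subseteq> I} \<and> N = M} = (if set_mset M \<subseteq> I then {M} else {})" by auto
  then show ?thesis by (simp add: monomials_gf_def formal_sum.rep_eq)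
qed

text \<open>Multiplication by \<open>1 - x_i\<close> cancels the geometric series in
  \<open>x_i\<close>.\<close>

lemma monomials_gf_remove:
  assumes "i \<in> I"
  shows "(1 - mmonom 1 {#i#}) * monomials_gf I = monomials_gf (I - {i})"
proof (rule mseries_eqI)
  fix M
  have "set_mset (M - {#i#}) \<subseteq> I \<longleftrightarrow> set_mset M \<subseteq> I" if "i \<in># M"
    using assms insert_DiffM [OF that] by (metis insert_subset set_mset_add_mset_insert)
  then show "mcoeff ((1 - mmonom 1 {#i#}) * monomials_gf I) M = mcoeff (monomials_gf (I - {i})) M"
    by (auto simp: left_diff_distrib mcoeff_monomials_gf)
qed

text \<open>
  Only finitely many variables occur in a given monomial, so a coefficient of the limit is already
  a coefficient at a large enough \<open>k\<close>; this is how \<open>k \<rightarrow> \<infinity>\<close> is taken below.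
\<close>

lemma tree_gf_quadratic:
  fixes c d :: "'a::comm_ring_1"
  assumes cd: "c + d = 1" "c * d = 1"
  defines "g \<equiv> tree_gf 1 c 1 d UNIV"
  shows "(1 + g)\<^sup>2 = (1 + g + g\<^sup>2) * monomials_gf {0<..}"
proof -
  let ?t = "tree_gf 1 c 1 d" and ?c = "mmonom c {#}" and ?d = "mmonom d {#}"
  define s where "s i = ?t {..i}" for i
  define L where "L i = 1 + s i + ?c * (g - s i)" for i
  define R where "R i = 1 + (g - s i) + ?d * s i" for i
  let ?H = "\<lambda>i. monomials_gf {i<..} :: 'a mseries"
  have cd': "?c + ?d = 1" "?c * ?d = 1"
    using cd by (simp_all flip: mmonom_0_hom)
  have gt: "?t {i<..} = g - s i" for i
  proof -
    have "{..i} \<union> {i<..} = UNIV" by auto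
    moreover have "{..i} \<inter> {i<..} = {}" by auto
    ultimately show ?thesis
      using tree_gf_Un [of "{..i}" "{i<..}" 1 c 1 d] by (simp add: g_def s_def algebra_simps)
  qed
  \<comment> \<open>The right ascents come from \<open>{Suc k..}\<close>, the complement of
    \<open>{..k}\<close>; hence the index \<open>k\<close> on \<open>R\<close> against
    \<open>Suc k\<close> on \<open>L\<close>.\<close>
  have root: "?t {Suc k} = mmonom 1 {#Suc k#} * (L (Suc k) * R k)" for k
    using tree_gf_root [of "Suc k" 1 c 1 d]
    by (simp add: atLeast_Suc_greaterThan gt lessThan_Suc_atMost mmonom_0_hom L_def R_def)
       (simp add: s_def)
  have s_Suc: "s (Suc k) = s k + ?t {Suc k}" for k
    using tree_gf_Un [of "{..k}" "{Suc k}" 1 c 1 d] by (simp add: s_def atMost_Suc)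
  have step: "L (Suc k) * R k * (1 - mmonom 1 {#Suc k#}) = L k * R (Suc k)" for k
  proof -
    define x where "x = mmonom (1 :: 'a) {#Suc k#}"
    define y where "y = s k"
    define z where "z = x * (L (Suc k) * R k)"
    have d: "?d = 1 - ?c" using cd'(1) by (simp add: eq_diff_eq add.commute)
    have "?c * ?c = ?c - ?c * ?d" by (simp add: d right_diff_distrib)
    then have c2: "?c * ?c = ?c - 1" by (simp add: cd')
    then have c2': "?c * (?c * f) = ?c * f - f" for f
      by (simp flip: mult.assoc add: left_diff_distrib)
    have s': "s (Suc k) = y + z" by (simp add: s_Suc root x_def y_def z_def)
    \<comment> \<open>The slopes are \<open>1 - c = d\<close> for \<open>L\<close> and
      \<open>d - 1 = - c\<close> for \<open>R\<close>.\<close>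
    have L': "L (Suc k) = L k + ?d * z" and R': "R (Suc k) = R k - ?c * z"
      using s' by (auto simp: L_def R_def y_def d algebra_simps)
    have inv: "?c * L k + ?d * R k = 1"
      by (simp add: L_def R_def d c2 c2' algebra_simps)
    \<comment> \<open>The changes of \<open>L\<close> and \<open>R\<close> combine to the linear
      form that \<open>inv\<close> evaluates to 1.\<close>
    have "L k * R (Suc k) = L (Suc k) * R k - z * (?d * R k + ?c * L k)"
      by (simp add: L' R' algebra_simps)
    also have "\<dots> = L (Suc k) * R k * (1 - x)"
      using inv by (simp add: add.commute z_def algebra_simps)
    finally show ?thesis by (simp add: x_def)
  qed
  \<comment> \<open>Division-free form of: \<open>L k / R k\<close> times the series in the
    variables beyond \<open>k\<close> does not depend on \<open>k\<close>.\<close>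
  have invariant: "L k * R 0 * ?H k = L 0 * R k * ?H 0" for k
  proof (induction k)
    case (Suc k)
    have H: "?H (Suc k) = (1 - mmonom 1 {#Suc k#}) * ?H k"
    proof -
      have "{k<..} - {Suc k} = {Suc k<..}" by auto
      then show ?thesis by (simp add: monomials_gf_remove)
    qed
    show ?case
    proof (rule unit_times_cancel)
      show "mcoeff (R k) {#} = 1"
        by (simp add: R_def g_def s_def mcoeff_tree_gf_empty)
      have "R k * (L (Suc k) * R 0 * ?H (Suc k)) =
          (L (Suc k) * R k * (1 - mmonom 1 {#Suc k#})) * R 0 * ?H k"
        by (simp add: H ac_simps)
      also have "\<dots> = R (Suc k) * (L k * R 0 * ?H k)"
        by (simp only: step) (simp add: ac_simps)
      also have "\<dots> = R k * (L 0 * R (Suc k) * ?H 0)"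
        by (simp only: Suc.IH) (simp add: ac_simps)
      finally show "R k * (L (Suc k) * R 0 * ?H (Suc k)) = R k * (L 0 * R (Suc k) * ?H 0)" .
    qed
  qed simp
  have s0: "s 0 = 0" by (simp add: s_def tree_gf_0)
  \<comment> \<open>The invariant in the limit of large \<open>k\<close>, where \<open>s k\<close>
    tends to \<open>g\<close> and the series in the remaining variables to 1.\<close>
  have "(1 + g) * R 0 * 1 = L 0 * (1 + ?d * g) * ?H 0"
  proof (rule mseries_eqI)
    fix M :: "nat multiset"
    obtain k where k: "set_mset M \<subseteq> {..k}"
      using finite_nat_iff_bounded_le [of "set_mset M"] by auto
    have s: "mcoeff (s k) A = mcoeff g A" if "A \<subseteq># M" for A
      using k set_mset_mono [OF that] unfolding s_def g_def
      by (intro mcoeff_tree_gf_cong) auto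
    have gs: "mcoeff (f * (g - s k)) A = 0" if "A \<subseteq># M" for f A
      using mcoeff_times_cong [of A f f "g - s k" 0] s subset_mset.trans [OF _ that] by simp
    have "mcoeff ((1 + g) * R 0 * 1) M = mcoeff (L k * R 0 * ?H k) M"
    proof (intro mcoeff_times_cong)
      fix A B assume *: "A \<subseteq># M"
      show "mcoeff 1 A = mcoeff (?H k) A"
        using k set_mset_mono [OF *] by (cases A) (auto simp: mcoeff_monomials_gf)
      assume "B \<subseteq># A"
      with * have "B \<subseteq># M" by simp
      then show "mcoeff (1 + g) B = mcoeff (L k) B" by (simp add: L_def s gs)
    qed simp
    also have "\<dots> = mcoeff (L 0 * R k * ?H 0) M" by (simp add: invariant)
    also have "\<dots> = mcoeff (L 0 * (1 + ?d * g) * ?H 0) M"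
    proof (intro mcoeff_times_cong)
      fix A B assume "A \<subseteq># M" "B \<subseteq># A"
      then have "B \<subseteq># M" by simp
      moreover from this have "mcoeff (?d * s k) B = mcoeff (?d * g) B" by (simp add: s)
      ultimately show "mcoeff (R k) B = mcoeff (1 + ?d * g) B" by (simp add: R_def s)
    qed simp_all
    finally show "mcoeff ((1 + g) * R 0 * 1) M = mcoeff (L 0 * (1 + ?d * g) * ?H 0) M" .
  qed
  \<comment> \<open>\<open>L 0\<close> is \<open>1 + c g\<close>, and its product with
    \<open>1 + d g\<close> becomes \<open>1 + g + g^2\<close> by
    \<open>c + d = c d = 1\<close>.\<close>
  moreover have "(1 + ?c * g) * (1 + ?d * g) = 1 + (?c + ?d) * g + (?c * ?d) * g\<^sup>2"
    by (simp add: algebra_simps power2_eq_square)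
  ultimately show ?thesis
    by (simp add: cd' L_def R_def s0 power2_eq_square)
qed

section \<open>The Motzkin recurrence and its functional equation\<close>

lemma Mot_0: "Mot 0 = 1"
proof -
  have "{T :: unit tree. size T = 0 \<and> right_needs_left T} = {Leaf}" by auto
  then show ?thesis by (simp add: Mot_def)
qed

text \<open>Without a right subtree the left one is arbitrary; a nonempty right subtree forces a
  nonempty left one, so both sizes are positive. With \<open>Mot 0 = 1\<close> this says
  \<open>m = x (1 + m + m^2)\<close> for the generating function \<open>m\<close> of the
  \<open>Mot k\<close> with \<open>k \<ge> 1\<close>.\<close>

lemma Mot_Suc: "Mot (Suc n) = Mot n + (\<Sum>i\<in>{1..<n}. Mot i * Mot (n - i))"
proof -
  define S where "S n = {T :: unit tree. size T = n \<and> right_needs_left T}" for n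
  have fin: "finite (S k)" for k by (simp add: S_def finite_Mot)
  let ?N = "\<lambda>(l, r). Node l () r"
  have eq: "S (Suc n) = ?N ` (S n \<times> {Leaf}) \<union> (\<Union>i\<in>{1..<n}. ?N ` (S i \<times> S (n - i)))"
    (is "_ = ?A \<union> ?B")
  proof (intro equalityI subsetI)
    fix T assume T: "T \<in> S (Suc n)"
    then obtain l r where lr: "T = Node l () r" by (cases T) (auto simp: S_def)
    show "T \<in> ?A \<union> ?B"
    proof (cases "r = Leaf")
      case True
      then show ?thesis using T lr by (auto simp: S_def)
    next
      case False
      with T lr have "l \<noteq> Leaf" by (simp add: S_def)
      with False have "size l > 0" "size r > 0" by (simp_all add: neq0_conv [symmetric] del: neq0_conv)
      moreover have "size l + size r = n" "right_needs_left l" "right_needs_left r"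
        using T lr by (simp_all add: S_def)
      ultimately have "size l \<in> {1..<n}" "(l, r) \<in> S (size l) \<times> S (n - size l)"
        by (auto simp: S_def)
      then show ?thesis using lr by (intro UnI2 UN_I [of "size l"] image_eqI [of _ _ "(l, r)"]) auto
    qed
  next
    fix T assume "T \<in> ?A \<union> ?B"
    then consider l where "l \<in> S n" "T = Node l () Leaf"
      | i l r where "1 \<le> i" "i < n" "l \<in> S i" "r \<in> S (n - i)" "T = Node l () r"
      by auto
    then show "T \<in> S (Suc n)" by cases (auto simp: S_def)
  qed
  have "card (S (Suc n)) = card ?A + card ?B"
    unfolding eq by (rule card_Un_disjoint) (simp_all add: fin, auto simp: S_def)
  also have "card ?A = card (S n)"
    by (subst card_image) (auto simp: inj_on_def card_cartesian_product)
  also have "card ?B = (\<Sum>i\<in>{1..<n}. card (?N ` (S i \<times> S (n - i))))"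
    by (rule card_UN_disjoint) (simp_all add: fin, auto simp: S_def)
  also have "\<dots> = (\<Sum>i\<in>{1..<n}. card (S i) * card (S (n - i)))"
    by (intro sum.cong refl, subst card_image) (auto simp: inj_on_def card_cartesian_product)
  finally show ?thesis by (simp add: Mot_def S_def)
qed

text \<open>As \<open>K\<close> has no constant term, the equation has only one solution, and the
  Motzkin series evaluated at \<open>K\<close> is one. Powers \<open>K ^ k\<close> with
  \<open>k > size M\<close> do not reach \<open>M\<close>, so a finite sum is enough.\<close>

lemma mcoeff_motzkin_solution:
  assumes g: "g = K * (1 + g + g\<^sup>2)" and K: "mcoeff K {#} = 0"
  shows "mcoeff g M = (\<Sum>k = 1..size M. of_nat (Mot k) * mcoeff (K ^ k) M)"
proof -
  define n where "n = size M"
  define p :: "'a mseries poly" where "p = (\<Sum>k = 1..n. monom (of_nat (Mot k)) k)"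
  have p: "coeff p k = (if k \<in> {1..n} then of_nat (Mot k) else 0)" for k
    by (simp add: p_def coeff_sum if_distrib [of of_nat])
  \<comment> \<open>the partial sum \<open>F\<close> solves the equation modulo \<open>K\<^sup>n\<^sup>+\<^sup>1\<close>, which does not affect degrees up to \<open>n\<close>\<close>
  define F where "F = poly p K"
  have F: "F = (\<Sum>k = 1..n. of_nat (Mot k) * K ^ k)"
    by (simp add: F_def p_def poly_sum poly_monom)
  \<comment> \<open>With an indeterminate in place of \<open>K\<close>, the equation up to degree
    \<open>n\<close> is the recurrence \<open>Mot_Suc\<close>.\<close>
  have "coeff (p - pCons 0 (1 + p + p * p)) k = 0" if "k < Suc n" for k
  proof (cases k)
    case 0
    then show ?thesis by (simp add: p)
  next
    case (Suc j)
    have "coeff (p * p) j = (\<Sum>i\<in>{1..<j}. of_nat (Mot i * Mot (j - i)))"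
      unfolding coeff_mult
      by (rule sum.mono_neutral_cong_right) (use that Suc in \<open>auto simp: p\<close>)
    then show ?thesis using that Suc by (cases j) (auto simp: p Mot_Suc Mot_0)
  qed
  then have "monom 1 (Suc n) dvd p - pCons 0 (1 + p + p * p)"
    by (simp add: monom_1_dvd_iff')
  then obtain q where "p - pCons 0 (1 + p + p * p) = monom 1 (Suc n) * q" by (elim dvdE)
  then have "poly (p - pCons 0 (1 + p + p * p)) K = poly (monom 1 (Suc n) * q) K" by simp
  then have FQ: "F - K * (1 + F + F * F) = K ^ Suc n * poly q K"
    by (simp add: F_def poly_monom)
  \<comment> \<open>Subtracting the equations of \<open>g\<close> and \<open>F\<close> lets
    \<open>g - F\<close> factor out; the cofactor has constant term 1 and can be cancelled degree by
    degree.\<close>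
  have e: "(1 - K * (1 + g + F)) * (g - F) = - (K ^ Suc n * poly q K)"
  proof -
    have "(1 - K * (1 + g + F)) * (g - F) = (g - K * (1 + g + g\<^sup>2)) - (F - K * (1 + F + F * F))"
      by (simp add: algebra_simps power2_eq_square)
    then show ?thesis using g by (simp add: FQ)
  qed
  have "mcoeff (g - F) M = 0"
  proof (rule mcoeff_eq_0_if_unit_times)
    show "mcoeff (1 - K * (1 + g + F)) {#} = 1"
      by (simp add: mcoeff_times_empty K)
    show "mcoeff ((1 - K * (1 + g + F)) * (g - F)) N = 0" if "size N \<le> n" for N
      unfolding e using that mcoeff_power_eq_0 [OF K, of N "Suc n"] by simp
    show "size M \<le> n" by (simp add: n_def)
  qed
  then show ?thesis by (simp add: F n_def)
qed

section \<open>Compositions and words\<close>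

lemma mcoeff_hom_sym:
  "mcoeff (hom_sym k) M = (if size M = k \<and> (\<forall>i\<in>#M. 0 < i) then 1 else 0)"
proof -
  have eq: "{N. N \<in> {M. size M = k \<and> (\<forall>i\<in>#M. 0 < i)} \<and> N = M} =
      (if size M = k \<and> (\<forall>i\<in>#M. 0 < i) then {M} else {})" by auto
  show ?thesis unfolding hom_sym_def formal_sum.rep_eq eq by auto
qed

section \<open>Compositions of n as subsets of {1, ..., n - 1}\<close>

lemma comp_set_Nil: "comp_set [] = {}"
  by (simp add: comp_set_def)

text \<open>The total is left out of the partial sums, so \<open>a\<close> counts only when further
  parts follow.\<close>

lemma comp_set_Cons:
  "comp_set (a # \<beta>) = (if \<beta> = [] then {} else insert a ((+) a ` comp_set \<beta>))"
proof (cases "\<beta> = []")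
  case False
  have "x \<in> comp_set (a # \<beta>) \<longleftrightarrow> x = a \<or> x \<in> (+) a ` comp_set \<beta>" for x
  proof
    assume "x \<in> comp_set (a # \<beta>)"
    then obtain i where i: "x = sum_list (take i (a # \<beta>))" "1 \<le> i" "i < Suc (length \<beta>)"
      by (auto simp: comp_set_def)
    then obtain j where "i = Suc j" by (cases i) auto
    moreover from this i have "sum_list (take j \<beta>) \<in> comp_set \<beta>" if "j > 0"
      using that unfolding comp_set_def by force
    ultimately show "x = a \<or> x \<in> (+) a ` comp_set \<beta>"
      using i by (cases "j = 0") auto
  next
    assume "x = a \<or> x \<in> (+) a ` comp_set \<beta>"
    then consider "x = a" | i where "x = a + sum_list (take i \<beta>)" "1 \<le> i" "i < length \<beta>"
      by (auto simp: comp_set_def)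
    then show "x \<in> comp_set (a # \<beta>)"
    proof cases
      case 1
      with False show ?thesis by (auto simp: comp_set_def intro!: exI [of _ 1])
    next
      case (2 i)
      then show ?thesis by (auto simp: comp_set_def intro!: exI [of _ "Suc i"])
    qed
  qed
  with False show ?thesis by auto
qed (simp add: comp_set_def)

lemma comp_set_subset: "\<forall>a\<in>set \<alpha>. 0 < a \<Longrightarrow> comp_set \<alpha> \<subseteq> {1..<sum_list \<alpha>}"
proof (induction \<alpha>)
  case (Cons a \<beta>)
  then have "sum_list \<beta> > 0" if "\<beta> \<noteq> []" using that by (cases \<beta>) auto
  with Cons show ?case by (auto simp: comp_set_Cons)
qed (simp add: comp_set_Nil)

lemma finite_comp_set: "finite (comp_set \<alpha>)"
  by (induction \<alpha>) (auto simp: comp_set_Nil comp_set_Cons)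

lemma length_eq_card_comp_set:
  assumes "\<forall>a\<in>set \<alpha>. 0 < a" and "\<alpha> \<noteq> []"
  shows "length \<alpha> = Suc (card (comp_set \<alpha>))"
  using assms
proof (induction \<alpha>)
  case (Cons a \<beta>)
  show ?case
  proof (cases "\<beta> = []")
    case False
    have "a \<notin> (+) a ` comp_set \<beta>" using comp_set_subset [of \<beta>] Cons.prems by auto
    with False Cons show ?thesis
      by (simp add: comp_set_Cons finite_comp_set card_image)
  qed (simp add: comp_set_Cons comp_set_Nil)
qed simp

text \<open>The first part is the least element of the set; the other elements, shifted down by it,
  determine the remaining parts.\<close>

lemma comp_set_inj:
  assumes "\<alpha> \<in> compositions n" and "\<alpha>' \<in> compositions n" and "comp_set \<alpha> = comp_set \<alpha>'"
  shows "\<alpha> = \<alpha>'"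
  using assms
proof (induction \<alpha> arbitrary: \<alpha>' n)
  case Nil
  then show ?case by (cases \<alpha>') (auto simp: compositions_def)
next
  case (Cons a \<beta>)
  then obtain b \<beta>' where \<alpha>': "\<alpha>' = b # \<beta>'" by (cases \<alpha>') (auto simp: compositions_def)
  show ?case
  proof (cases "\<beta> = [] \<or> \<beta>' = []")
    case True
    with Cons.prems(3) have "\<beta> = []" "\<beta>' = []"
      by (auto simp: \<alpha>' comp_set_Cons split: if_splits)
    with Cons.prems show ?thesis by (simp add: \<alpha>' compositions_def)
  next
    case False
    have pos: "comp_set \<beta> \<subseteq> {1..}" "comp_set \<beta>' \<subseteq> {1..}"
      using comp_set_subset [of \<beta>] comp_set_subset [of \<beta>'] Cons.prems(1,2)
      by (auto simp: \<alpha>' compositions_def)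
    have eq: "insert a ((+) a ` comp_set \<beta>) = insert b ((+) b ` comp_set \<beta>')"
      using Cons.prems(3) False by (simp add: \<alpha>' comp_set_Cons)
    then have "a \<in> insert b ((+) b ` comp_set \<beta>')" "b \<in> insert a ((+) a ` comp_set \<beta>)"
      by blast+
    then have "a = b" by auto
    have "a \<notin> (+) a ` comp_set \<beta>" "a \<notin> (+) a ` comp_set \<beta>'" using pos by auto
    then have "(+) a ` comp_set \<beta> = (+) a ` comp_set \<beta>'"
      using eq \<open>a = b\<close> by (metis insert_ident)
    then have "comp_set \<beta> = comp_set \<beta>'" by (simp add: inj_image_eq_iff)
    then have "\<beta> = \<beta>'"
      by (intro Cons.IH [of "n - a"])
         (use Cons.prems \<open>a = b\<close> in \<open>auto simp: \<alpha>' compositions_def\<close>)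
    with \<open>a = b\<close> show ?thesis by (simp add: \<alpha>')
  qed
qed

text \<open>Strong induction on \<open>n\<close>: the least element of \<open>S\<close> becomes the
  first part, and the rest of \<open>S\<close>, shifted down by it, yields the other parts. For
  \<open>S = {}\<close> the composition is \<open>[n]\<close>, or \<open>[]\<close> when
  \<open>n = 0\<close>.\<close>

lemma comp_set_surj:
  assumes "S \<subseteq> {1..<n}"
  shows "\<exists>\<alpha>\<in>compositions n. comp_set \<alpha> = S"
  using assms
proof (induction n arbitrary: S rule: less_induct)
  case (less n)
  consider "n = 0" | "n > 0" "S = {}" | "S \<noteq> {}" by auto
  then show ?case
  proof cases
    case 1
    with less.prems show ?thesis
      by (intro bexI [of _ "[]"]) (auto simp: comp_set_Nil compositions_def)
  next
    case 2
    then show ?thesis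
      by (intro bexI [of _ "[n]"]) (auto simp: comp_set_Cons compositions_def)
  next
    case 3
    define a where "a = Min S"
    have fin: "finite S" using less.prems by (rule finite_subset) simp
    with 3 have "a \<in> S" and a: "\<And>s. s \<in> S \<Longrightarrow> a \<le> s" by (auto simp: a_def)
    with less.prems have an: "1 \<le> a" "a < n" by auto
    define S' where "S' = {s. 0 < s \<and> a + s \<in> S}"
    have "S' \<subseteq> {1..<n - a}" using less.prems by (auto simp: S'_def)
    moreover have "n - a < n" using an by simp
    ultimately obtain \<beta> where \<beta>: "\<beta> \<in> compositions (n - a)" "comp_set \<beta> = S'"
      using less.IH [of "n - a" S'] by blast
    with an have "\<beta> \<noteq> []" by (auto simp: compositions_def)
    moreover have "insert a ((+) a ` S') = S"
    proof -
      have "s \<in> insert a ((+) a ` S')" if "s \<in> S" for s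
        using a [OF that] that by (cases "s = a") (auto simp: S'_def image_iff intro!: exI [of _ "s - a"])
      with \<open>a \<in> S\<close> show ?thesis by (auto simp: S'_def)
    qed
    ultimately show ?thesis
      using \<beta> an by (intro bexI [of _ "a # \<beta>"]) (auto simp: comp_set_Cons compositions_def)
  qed
qed

lemma bij_betw_comp_set: "bij_betw comp_set (compositions n) (Pow {1..<n})"
  unfolding bij_betw_def
proof
  show "inj_on comp_set (compositions n)" by (auto intro!: inj_onI comp_set_inj)
  have "comp_set \<alpha> \<subseteq> {1..<n}" if "\<alpha> \<in> compositions n" for \<alpha>
    using comp_set_subset [of \<alpha>] that by (simp add: compositions_def)
  then show "comp_set ` compositions n = Pow {1..<n}" using comp_set_surj [of _ n] by blast
qed

section \<open>Words with restricted descents\<close>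

lemma descent_set_subset: "descent_set w \<subseteq> {1..<length w}"
  by (auto simp: descent_set_def)

text \<open>The sorted block has no descent inside, one is allowed at the junction
  \<open>length u\<close>, and those of \<open>v\<close> are shifted. The last assumption ensures
  that the junction lies in \<open>comp_set\<close> when \<open>v\<close> is nonempty.\<close>

lemma descent_set_append_sorted:
  assumes u: "sorted u" and v: "descent_set v \<subseteq> comp_set \<beta>" and "v \<noteq> [] \<Longrightarrow> \<beta> \<noteq> []"
  shows "descent_set (u @ v) \<subseteq> comp_set (length u # \<beta>)"
proof
  fix i assume "i \<in> descent_set (u @ v)"
  then have i: "1 \<le> i" "i < length u + length v" "(u @ v) ! (i - 1) > (u @ v) ! i"
    by (auto simp: descent_set_def)
  have "i \<ge> length u"
  proof (rule ccontr)
    assume "\<not> i \<ge> length u"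
    with u have "u ! (i - 1) \<le> u ! i" by (intro sorted_nth_mono) auto
    with i \<open>\<not> i \<ge> length u\<close> show False by (auto simp: nth_append split: if_splits)
  qed
  with i have "v \<noteq> []" by auto
  with assms(3) have \<beta>: "\<beta> \<noteq> []" by simp
  show "i \<in> comp_set (length u # \<beta>)"
  proof (cases "i = length u")
    case False
    with i \<open>i \<ge> length u\<close> have "i - length u \<in> descent_set v"
      by (auto simp: descent_set_def nth_append Suc_diff_le diff_commute split: if_splits)
    with v have "i - length u \<in> comp_set \<beta>" by auto
    with \<beta> \<open>i \<ge> length u\<close> show ?thesis
      by (auto simp: comp_set_Cons intro!: image_eqI [of _ _ "i - length u"])
  qed (use \<beta> in \<open>simp add: comp_set_Cons\<close>)
qed

lemma sorted_take_descent:
  assumes "descent_set w \<subseteq> {a..}"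
  shows "sorted (take a w)"
  unfolding sorted_iff_nth_Suc
proof (intro allI impI)
  fix i assume "Suc i < length (take a w)"
  with assms have "Suc i \<notin> descent_set w" "Suc i < length w" by auto
  with \<open>Suc i < length (take a w)\<close> show "take a w ! i \<le> take a w ! Suc i"
    by (auto simp: descent_set_def)
qed

lemma descent_set_drop:
  assumes "i \<in> descent_set (drop a w)" shows "a + i \<in> descent_set w"
proof -
  from assms have "1 \<le> i" "i < length w - a" "drop a w ! (i - 1) > drop a w ! i"
    by (auto simp: descent_set_def)
  moreover have "a + (i - 1) = a + i - 1" using \<open>1 \<le> i\<close> by simp
  ultimately show ?thesis by (auto simp: descent_set_def)
qed

text \<open>Cut a word into blocks of lengths \<open>\<alpha>\<close>. Descents are allowed only at
  block ends, so each block is weakly increasing and amounts to an arbitrary multiset of its size,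
  as enumerated by \<open>hom_sym\<close>.\<close>

lemma hom_sym_comp_eq_words:
  assumes "\<forall>a\<in>set \<alpha>. 0 < a"
  shows "hom_sym_comp \<alpha> = formal_sum
    {w. length w = sum_list \<alpha> \<and> (\<forall>a\<in>set w. 0 < a) \<and> descent_set w \<subseteq> comp_set \<alpha>} (\<lambda>_. 1) mset"
  using assms
proof (induction \<alpha>)
  case Nil
  have "{w. length w = sum_list [] \<and> (\<forall>a\<in>set w. 0 < a) \<and> descent_set w \<subseteq> comp_set []} = {[]}"
    by (auto simp: descent_set_def)
  moreover have "formal_sum {[]} (\<lambda>_. 1) mset = (1 :: 'a mseries)"
    by (rule mseries_eqI) (auto simp: formal_sum.rep_eq Collect_conv_if)
  ultimately show ?case by (simp add: hom_sym_comp_def)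
next
  case (Cons a \<beta>)
  define W where
    "W \<alpha> = {w. length w = sum_list \<alpha> \<and> (\<forall>a\<in>set w. 0 < a) \<and> descent_set w \<subseteq> comp_set \<alpha>}" for \<alpha>
  define X where "X = {M. size M = a \<and> (\<forall>i\<in>#M. 0 < (i :: nat))}"
  have \<beta>: "\<forall>a\<in>set \<beta>. 0 < a" using Cons.prems by simp
  have W_sorted: "sorted (take a w)" and W_drop: "descent_set (drop a w) \<subseteq> comp_set \<beta>"
    if "w \<in> W (a # \<beta>)" for w
  proof -
    have w: "descent_set w \<subseteq> insert a ((+) a ` comp_set \<beta>)"
      using that by (auto simp: W_def comp_set_Cons split: if_splits)
    then show "sorted (take a w)" by (intro sorted_take_descent) auto
    show "descent_set (drop a w) \<subseteq> comp_set \<beta>"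
    proof
      fix i assume i: "i \<in> descent_set (drop a w)"
      then have "i \<noteq> 0" by (simp add: descent_set_def)
      then show "i \<in> comp_set \<beta>" using descent_set_drop [OF i] w by auto
    qed
  qed
  have len: "length (sorted_list_of_multiset M) = a" if "M \<in> X" for M
    using that by (metis (mono_tags) X_def mem_Collect_eq mset_sorted_list_of_multiset size_mset)
  \<comment> \<open>The first block is recovered from its multiset by sorting; the inverse forgets
    the order of the first \<open>a\<close> letters.\<close>
  have bij: "bij_betw (\<lambda>(M, w). sorted_list_of_multiset M @ w) (X \<times> W \<beta>) (W (a # \<beta>))"
  proof (rule bij_betw_byWitness [where f' = "\<lambda>w. (mset (take a w), drop a w)"])
    show "(\<lambda>(M, w). sorted_list_of_multiset M @ w) ` (X \<times> W \<beta>) \<subseteq> W (a # \<beta>)"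
    proof safe
      fix M w assume M: "M \<in> X" and w: "w \<in> W \<beta>"
      have "w \<noteq> [] \<Longrightarrow> \<beta> \<noteq> []" using w by (auto simp: W_def)
      then have "descent_set (sorted_list_of_multiset M @ w) \<subseteq> comp_set (a # \<beta>)"
        using descent_set_append_sorted [of "sorted_list_of_multiset M" w \<beta>] w len [OF M]
        by (auto simp: W_def)
      then show "sorted_list_of_multiset M @ w \<in> W (a # \<beta>)"
        using M w len [OF M] by (auto simp: W_def X_def)
    qed
    show "(\<lambda>w. (mset (take a w), drop a w)) ` W (a # \<beta>) \<subseteq> X \<times> W \<beta>"
      using W_drop by (auto simp: X_def) (auto simp: W_def dest: in_set_takeD in_set_dropD)
    show "\<forall>w\<in>W (a # \<beta>). (\<lambda>(M, w). sorted_list_of_multiset M @ w) (mset (take a w), drop a w) = w"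
      using W_sorted by (simp add: sorted_list_of_multiset_mset sorted_sort_id)
    show "\<forall>p\<in>X \<times> W \<beta>. (\<lambda>w. (mset (take a w), drop a w))
        ((\<lambda>(M, w). sorted_list_of_multiset M @ w) p) = p" using len by auto
  qed
  have "hom_sym_comp (a # \<beta>) = (formal_sum X (\<lambda>_. 1) (\<lambda>M. M) :: 'a mseries) *
      formal_sum (W \<beta>) (\<lambda>_. 1) mset"
    using Cons.IH [OF \<beta>] by (simp add: hom_sym_comp_def hom_sym_def X_def W_def)
  also have "\<dots> = formal_sum (X \<times> W \<beta>) (\<lambda>_. 1) (\<lambda>(M, w). M + mset w)"
  proof (subst formal_sum_times)
    show "finite_fibres X (\<lambda>M. M)" by (simp add: finite_fibres_def)
    show "finite_fibres (W \<beta>) mset" by (simp add: finite_fibres_def finite_words_mset)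
  qed (auto intro: formal_sum_cong)
  also have "\<dots> = formal_sum (W (a # \<beta>)) (\<lambda>_. 1) mset"
    unfolding formal_sum_reindex [OF bij] by (rule formal_sum_cong) auto
  finally show ?case by (simp add: W_def)
qed

lemma mcoeff_hom_sym_comp_eq_card:
  assumes "\<forall>a\<in>set \<alpha>. 0 < a"
  shows "mcoeff (hom_sym_comp \<alpha>) M = (if size M = sum_list \<alpha> then
    of_nat (card {w. mset w = M \<and> (\<forall>a\<in>set w. 0 < a) \<and> descent_set w \<subseteq> comp_set \<alpha>}) else 0)"
proof -
  have "{w. (length w = sum_list \<alpha> \<and> (\<forall>a\<in>set w. 0 < a) \<and> descent_set w \<subseteq> comp_set \<alpha>) \<and> mset w = M} =
    (if size M = sum_list \<alpha> then
      {w. mset w = M \<and> (\<forall>a\<in>set w. 0 < a) \<and> descent_set w \<subseteq> comp_set \<alpha>} else {})"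
    by auto
  then show ?thesis by (simp add: hom_sym_comp_eq_words [OF assms] formal_sum.rep_eq)
qed

lemma mcoeff_ribbon:
  "mcoeff (ribbon \<alpha>) M = (if size M = sum_list \<alpha> then
    of_nat (card {w. mset w = M \<and> (\<forall>a\<in>set w. 0 < a) \<and> descent_set w = comp_set \<alpha>}) else 0)"
proof -
  have "{w. (length w = sum_list \<alpha> \<and> (\<forall>a\<in>set w. 0 < a) \<and> descent_set w = comp_set \<alpha>) \<and> mset w = M} =
    (if size M = sum_list \<alpha> then
      {w. mset w = M \<and> (\<forall>a\<in>set w. 0 < a) \<and> descent_set w = comp_set \<alpha>} else {})"
    by auto
  then show ?thesis by (simp add: ribbon_def formal_sum.rep_eq)
qed

section \<open>Expansion into symmetric functions\<close>

lemma sum_power_eq_sum_lists: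
  fixes f :: "'b \<Rightarrow> 'a::comm_ring_1"
  assumes "finite A"
  shows "(\<Sum>a\<in>A. f a) ^ k = (\<Sum>xs | set xs \<subseteq> A \<and> length xs = k. prod_list (map f xs))"
proof (induction k)
  case 0
  have "{xs. set xs \<subseteq> A \<and> length xs = 0} = {[]}" by auto
  then show ?case by simp
next
  case (Suc k)
  let ?X = "{xs. set xs \<subseteq> A \<and> length xs = k}"
  have "(\<Sum>a\<in>A. f a) ^ Suc k = (\<Sum>xs\<in>?X. \<Sum>a\<in>A. prod_list (map f xs) * f a)"
    by (simp add: power_Suc2 Suc.IH sum_product del: power_Suc)
  also have "\<dots> = (\<Sum>(xs, a)\<in>?X \<times> A. prod_list (map f xs) * f a)"
    by (rule sum.cartesian_product)
  also have "\<dots> = (\<Sum>xs\<in>(\<lambda>(xs, a). a # xs) ` (?X \<times> A). prod_list (map f xs))"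
    by (subst sum.reindex) (auto simp: inj_on_def mult.commute intro!: sum.cong)
  finally show ?case by (simp only: lists_length_Suc_eq)
qed

lemma length_le_sum_list:
  fixes \<alpha> :: "nat list"
  shows "\<forall>a\<in>set \<alpha>. 0 < a \<Longrightarrow> length \<alpha> \<le> sum_list \<alpha>"
  by (induction \<alpha>) fastforce+

text \<open>Up to degree \<open>n\<close>, \<open>monomials_gf {0<..} - 1\<close> agrees with
  \<open>h_1 + ... + h_n\<close>, whose \<open>k\<close>-th power expands over lists of
  \<open>k\<close> parts. In degree \<open>n\<close> only the lists with sum \<open>n\<close>
  survive.\<close>

lemma mcoeff_motzkin_hom_sym:
  assumes n: "size M = n" "n \<ge> 1"
  shows "(\<Sum>k = 1..n. of_nat (Mot k) * mcoeff ((monomials_gf {0<..} - 1) ^ k) M) =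
    mcoeff (\<Sum>\<alpha>\<in>compositions n. of_nat (Mot (length \<alpha>)) * hom_sym_comp \<alpha> :: 'a::comm_ring_1 mseries) M"
proof -
  let ?K = "monomials_gf {0<..} - 1 :: 'a mseries"
  let ?K' = "\<Sum>a\<in>{1..n}. hom_sym a :: 'a mseries"
  let ?h = "\<lambda>\<alpha>. of_nat (Mot (length \<alpha>)) * mcoeff (hom_sym_comp \<alpha> :: 'a mseries) M"
  let ?X = "{\<alpha>. set \<alpha> \<subseteq> {1..n} \<and> length \<alpha> \<in> {1..n}}"
  have K: "mcoeff ?K A = mcoeff ?K' A" if "A \<subseteq># M" for A
  proof (cases "A = {#}")
    case True
    then show ?thesis by (simp add: mcoeff_monomials_gf mcoeff_hom_sym)
  next
    case False
    then have "size A \<in> {1..n}"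
      using size_mset_mono [OF that] n by (auto simp: Suc_le_eq nonempty_has_size)
    then have "mcoeff ?K' A = (if \<forall>i\<in>#A. 0 < i then 1 else 0)"
      by (simp add: mcoeff_hom_sym if_distrib sum.delta' cong: if_cong)
    with False show ?thesis by (auto simp: mcoeff_monomials_gf intro: gr0I)
  qed
  have Kpow: "mcoeff (?K ^ k) A = mcoeff (?K' ^ k) A" if "A \<subseteq># M" for k A
    using that
  proof (induction k arbitrary: A)
    case (Suc k)
    have "mcoeff (?K * ?K ^ k) A = mcoeff (?K' * ?K' ^ k) A"
      by (rule mcoeff_times_cong) (meson K Suc subset_mset.trans)+
    then show ?case by simp
  qed simp
  have fin: "finite ?X"
    by (rule finite_subset [OF _ finite_lists_length_le [of "{1..n}" n]]) auto
  have "(\<Sum>k = 1..n. of_nat (Mot k) * mcoeff (?K ^ k) M) =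
      (\<Sum>k = 1..n. \<Sum>\<alpha> | \<alpha> \<in> ?X \<and> length \<alpha> = k. ?h \<alpha>)"
  proof (rule sum.cong)
    fix k assume k: "k \<in> {1..n}"
    have "{\<alpha>. set \<alpha> \<subseteq> {1..n} \<and> length \<alpha> = k} = {\<alpha>. \<alpha> \<in> ?X \<and> length \<alpha> = k}" using k by auto
    then show "of_nat (Mot k) * mcoeff (?K ^ k) M = (\<Sum>\<alpha> | \<alpha> \<in> ?X \<and> length \<alpha> = k. ?h \<alpha>)"
      by (simp only: Kpow [OF subset_mset.order_refl] sum_power_eq_sum_lists [OF finite_atLeastAtMost]
          mcoeff_sum sum_distrib_left hom_sym_comp_def) (auto intro!: sum.cong)
  qed simp
  also have "\<dots> = (\<Sum>\<alpha>\<in>?X. ?h \<alpha>)"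
    by (rule sum.group) (use fin in auto)
  also have "\<dots> = (\<Sum>\<alpha>\<in>compositions n. ?h \<alpha>)"
  proof (rule sum.mono_neutral_right)
    show "compositions n \<subseteq> ?X"
    proof
      fix \<alpha> assume "\<alpha> \<in> compositions n"
      then have \<alpha>: "\<forall>a\<in>set \<alpha>. 0 < a" "sum_list \<alpha> = n" by (auto simp: compositions_def)
      with n have "\<alpha> \<noteq> []" by auto
      with \<alpha> length_le_sum_list [OF \<alpha>(1)] show "\<alpha> \<in> ?X"
        by (auto simp: Suc_le_eq intro: member_le_sum_list)
    qed
    show "\<forall>\<alpha>\<in>?X - compositions n. ?h \<alpha> = 0"
    proof
      fix \<alpha> assume "\<alpha> \<in> ?X - compositions n"
      then have "\<forall>a\<in>set \<alpha>. 0 < a" "sum_list \<alpha> \<noteq> n" by (auto simp: compositions_def Suc_le_eq)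
      then show "?h \<alpha> = 0" using n by (simp add: mcoeff_hom_sym_comp_eq_card)
    qed
  qed (rule fin)
  finally show ?thesis by simp
qed

section \<open>From products of complete homogeneous functions to Foulkes characters\<close>

lemma sum_Pow_card:
  fixes f :: "nat \<Rightarrow> nat"
  assumes "finite Y"
  shows "(\<Sum>U\<in>Pow Y. f (card U)) = (\<Sum>k = 0..card Y. (card Y choose k) * f k)"
proof -
  have "(\<Sum>U\<in>Pow Y. f (card U)) = (\<Sum>k = 0..card Y. \<Sum>U | U \<in> Pow Y \<and> card U = k. f (card U))"
    by (rule sum.group [symmetric]) (use assms in \<open>auto intro: card_mono\<close>)
  also have "\<dots> = (\<Sum>k = 0..card Y. (card Y choose k) * f k)"
    by (rule sum.cong) (simp_all add: n_subsets [OF assms])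
  finally show ?thesis .
qed

text \<open>The complement \<open>X - S\<close> runs through the subsets of \<open>X - D\<close>;
  \<open>k\<close> is its size.\<close>

lemma sum_supersets_card:
  fixes f :: "nat \<Rightarrow> nat"
  assumes "finite X" and "D \<subseteq> X"
  shows "(\<Sum>S | S \<in> Pow X \<and> D \<subseteq> S. f (card S)) =
    (\<Sum>k = 0..card X - card D. (card X - card D choose k) * f (card X - k))"
proof -
  have "(\<Sum>S | S \<in> Pow X \<and> D \<subseteq> S. f (card S)) = (\<Sum>U\<in>Pow (X - D). f (card X - card U))"
  proof (rule sum.reindex_bij_witness [of _ "\<lambda>U. X - U" "\<lambda>S. X - S"])
    fix S assume "S \<in> {S. S \<in> Pow X \<and> D \<subseteq> S}"
    then have "finite S" "S \<subseteq> X" using assms finite_subset by auto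
    then show "f (card X - card (X - S)) = f (card S)"
      using assms by (simp add: card_Diff_subset card_mono)
  qed (use assms in auto)
  also have "\<dots> = (\<Sum>k = 0..card X - card D. (card X - card D choose k) * f (card X - k))"
    using assms by (simp add: sum_Pow_card [of "X - D" "\<lambda>k. f (card X - k)"] card_Diff_subset finite_subset)
  finally show ?thesis .
qed

text \<open>Both sides are compared word by word. A word with descent set \<open>D\<close> occurs in
  \<open>hom_sym_comp \<alpha>\<close> exactly when \<open>D \<subseteq> comp_set \<alpha>\<close>,
  so its total weight depends on \<open>card D\<close> only, and \<open>foulkes n (j - 1)\<close>
  enumerates the words with \<open>j - 1\<close> descents.\<close>

lemma sum_hom_sym_comp_eq_sum_foulkes:
  fixes f :: "nat \<Rightarrow> nat"
  assumes n: "n \<ge> 1"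
  shows "(\<Sum>\<alpha>\<in>compositions n. of_nat (f (length \<alpha>)) * (hom_sym_comp \<alpha> :: 'a::comm_ring_1 mseries)) =
    (\<Sum>j = 1..n. of_nat (\<Sum>k = 0..n - j. ((n - j) choose k) * f (n - k)) * foulkes n (j - 1))"
    (is "?lhs = ?rhs")
proof (rule mseries_eqI)
  fix M
  define c where "c j = (\<Sum>k = 0..n - j. ((n - j) choose k) * f (n - k))" for j
  have rhs: "mcoeff ?rhs M = (\<Sum>j = 1..n. of_nat (c j) * mcoeff (foulkes n (j - 1)) M)"
    by (simp add: c_def del: of_nat_sum)
  have comp: "\<forall>a\<in>set \<alpha>. 0 < a" "sum_list \<alpha> = n" "length \<alpha> = Suc (card (comp_set \<alpha>))"
    if "\<alpha> \<in> compositions n" for \<alpha>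
    using that n length_eq_card_comp_set [of \<alpha>] by (cases "\<alpha> = []"; simp add: compositions_def)+
  show "mcoeff ?lhs M = mcoeff ?rhs M"
  proof (cases "size M = n")
    case False
    then show ?thesis
      unfolding rhs using comp by (simp add: foulkes_def mcoeff_hom_sym_comp_eq_card mcoeff_ribbon)
  next
    case True
    define W where "W = {w. mset w = M \<and> (\<forall>a\<in>set w. 0 < a)}"
    have fin: "finite W"
      by (rule finite_subset [OF _ finite_words_mset [of "\<lambda>_. True" M]]) (auto simp: W_def)
    have D: "descent_set w \<subseteq> {1..<n}" if "w \<in> W" for w
      using that True descent_set_subset [of w] by (auto simp: W_def)
    have card_W: "card {w. mset w = M \<and> (\<forall>a\<in>set w. 0 < a) \<and> P w} = (\<Sum>w\<in>W. if P w then 1 else 0)" for P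
    proof -
      have "{w. mset w = M \<and> (\<forall>a\<in>set w. 0 < a) \<and> P w} = {w \<in> W. P w}" by (auto simp: W_def)
      then show ?thesis using fin by (simp add: sum.If_cases Int_def)
    qed
    have via_sets: "(\<Sum>\<alpha>\<in>compositions n. F (length \<alpha>) (comp_set \<alpha>)) = (\<Sum>S\<in>Pow {1..<n}. F (Suc (card S)) S)"
      for F :: "nat \<Rightarrow> nat set \<Rightarrow> nat"
      using sum.reindex_bij_betw [OF bij_betw_comp_set, of "\<lambda>S. F (Suc (card S)) S" n]
      by (simp add: comp cong: sum.cong)
    have "mcoeff ?lhs M = of_nat (\<Sum>\<alpha>\<in>compositions n. \<Sum>w\<in>W.
        if descent_set w \<subseteq> comp_set \<alpha> then f (length \<alpha>) else 0)"
      using comp True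
      by (simp add: mcoeff_hom_sym_comp_eq_card card_W sum_distrib_left if_distrib cong: if_cong)
    also have "(\<Sum>\<alpha>\<in>compositions n. \<Sum>w\<in>W. if descent_set w \<subseteq> comp_set \<alpha> then f (length \<alpha>) else 0) =
        (\<Sum>w\<in>W. c (Suc (card (descent_set w))))"
      unfolding sum.swap [of _ W]
    proof (rule sum.cong)
      fix w assume "w \<in> W"
      have "(\<Sum>\<alpha>\<in>compositions n. if descent_set w \<subseteq> comp_set \<alpha> then f (length \<alpha>) else 0) =
          (\<Sum>S | S \<in> Pow {1..<n} \<and> descent_set w \<subseteq> S. f (Suc (card S)))"
        using via_sets [of "\<lambda>l S. if descent_set w \<subseteq> S then f l else 0"]
          sum.inter_filter [of "Pow {1..<n}" "\<lambda>S. f (Suc (card S))" "\<lambda>S. descent_set w \<subseteq> S"]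
        by simp
      also have "\<dots> = (\<Sum>k = 0..n - Suc (card (descent_set w)).
          ((n - Suc (card (descent_set w))) choose k) * f (Suc (n - 1 - k)))"
        using sum_supersets_card [of "{1..<n}" "descent_set w" "\<lambda>m. f (Suc m)"] D [OF \<open>w \<in> W\<close>]
        by simp
      \<comment> \<open>\<open>Suc (n - 1 - k) = n - k\<close> on the summation range, where
        \<open>k \<le> n - 1\<close>.\<close>
      also have "\<dots> = c (Suc (card (descent_set w)))"
        unfolding c_def by (rule sum.cong) (use n in \<open>auto simp: Suc_diff_Suc\<close>)
      finally show "(\<Sum>\<alpha>\<in>compositions n. if descent_set w \<subseteq> comp_set \<alpha> then f (length \<alpha>) else 0) =
          c (Suc (card (descent_set w)))" .
    qed simp
    also have "\<dots> = (\<Sum>j = 1..n. \<Sum>w\<in>W. if Suc (card (descent_set w)) = j then c j else 0)"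
      unfolding sum.swap [of _ W]
    proof (rule sum.cong)
      fix w assume "w \<in> W"
      then have "card (descent_set w) \<le> card {1..<n}" using D by (intro card_mono) auto
      with n have "Suc (card (descent_set w)) \<in> {1..n}" by simp
      then show "c (Suc (card (descent_set w))) =
          (\<Sum>j = 1..n. if Suc (card (descent_set w)) = j then c j else 0)" by simp
    qed simp
    also have "of_nat \<dots> = mcoeff ?rhs M"
    proof -
      have foulkes: "mcoeff (foulkes n (j - 1)) M =
          of_nat (\<Sum>w\<in>W. if Suc (card (descent_set w)) = j then 1 else 0)" if "j \<in> {1..n}" for j
      proof -
        have "mcoeff (foulkes n (j - 1)) M =
            (\<Sum>\<alpha> | \<alpha> \<in> compositions n \<and> length \<alpha> = j. mcoeff (ribbon \<alpha>) M)"
          using that by (simp add: foulkes_def)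
        also have "\<dots> = (\<Sum>\<alpha> | \<alpha> \<in> compositions n \<and> length \<alpha> = j.
            of_nat (\<Sum>w\<in>W. if descent_set w = comp_set \<alpha> then 1 else 0))"
          by (rule sum.cong) (simp_all add: mcoeff_ribbon card_W comp(2) True)
        also have "\<dots> = of_nat (\<Sum>\<alpha>\<in>compositions n. if length \<alpha> = j then
              \<Sum>w\<in>W. if descent_set w = comp_set \<alpha> then 1 else 0 else 0)"
          by (simp only: of_nat_sum [symmetric] sum.inter_filter finite_compositions)
        also have "(\<Sum>\<alpha>\<in>compositions n. if length \<alpha> = j then
            \<Sum>w\<in>W. if descent_set w = comp_set \<alpha> then 1 else 0 else 0) =
            (\<Sum>S\<in>Pow {1..<n}. \<Sum>w\<in>W. if descent_set w = S \<and> Suc (card S) = j then 1 else (0::nat))"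
          by (subst via_sets) (auto intro!: sum.cong)
        \<comment> \<open>Each word is counted by a single ribbon, the one of its descent
          set.\<close>
        also have "\<dots> = (\<Sum>w\<in>W. if Suc (card (descent_set w)) = j then 1 else 0)"
          unfolding sum.swap [of _ W]
        proof (rule sum.cong)
          fix w assume "w \<in> W"
          have "(\<Sum>S\<in>Pow {1..<n}. if descent_set w = S \<and> Suc (card S) = j then 1 else (0::nat)) =
              (\<Sum>S\<in>{descent_set w}. if Suc (card S) = j then 1 else 0)"
            by (rule sum.mono_neutral_cong_right) (use D [OF \<open>w \<in> W\<close>] in auto)
          then show "(\<Sum>S\<in>Pow {1..<n}. if descent_set w = S \<and> Suc (card S) = j then 1 else (0::nat)) =
              (if Suc (card (descent_set w)) = j then 1 else 0)" by simp
        qed simp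
        finally show ?thesis .
      qed
      have "of_nat (\<Sum>w\<in>W. if Suc (card (descent_set w)) = j then c j else 0) =
          of_nat (c j) * mcoeff (foulkes n (j - 1)) M" if "j \<in> {1..n}" for j
        unfolding foulkes [OF that] of_nat_mult [symmetric] sum_distrib_left
        by (rule arg_cong [where f = of_nat], rule sum.cong) auto
      then show ?thesis
        unfolding rhs of_nat_sum [where A = "{1..n}"] by (rule sum.cong [OF refl])
    qed
    finally show ?thesis .
  qed
qed

section \<open>The sixth root of unity and the conclusion\<close>

lemma primitive_sixth_root:
  fixes \<zeta> :: complex
  assumes "\<zeta> ^ 6 = 1" and "\<forall>k\<in>{1..<6::nat}. \<zeta> ^ k \<noteq> 1"
  shows "inverse \<zeta> + \<zeta> = 1" and "inverse \<zeta> * \<zeta> = 1"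
proof -
  have "\<zeta> \<noteq> 0" using assms(1) by auto
  then show "inverse \<zeta> * \<zeta> = 1" by simp
  have "\<zeta> ^ 3 \<noteq> 1" "\<zeta> ^ 2 \<noteq> 1" using assms(2) by auto
  then have "\<zeta> + 1 \<noteq> 0" by (auto simp: add_eq_0_iff2)
  \<comment> \<open>The last factor is the sixth cyclotomic polynomial. Primitivity excludes the
    other two; \<open>\<zeta> = -1\<close> would have square 1.\<close>
  have "(\<zeta> ^ 3 - 1) * ((\<zeta> + 1) * (\<zeta>\<^sup>2 - \<zeta> + 1)) = \<zeta> ^ 6 - 1"
    by (simp add: algebra_simps power2_eq_square eval_nat_numeral)
  with assms(1) \<open>\<zeta> ^ 3 \<noteq> 1\<close> \<open>\<zeta> + 1 \<noteq> 0\<close> have "\<zeta>\<^sup>2 - \<zeta> + 1 = 0" by simp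
  then have "\<zeta> * (inverse \<zeta> + \<zeta>) = \<zeta> * 1"
    using \<open>\<zeta> \<noteq> 0\<close> by (simp add: algebra_simps power2_eq_square)
  with \<open>\<zeta> \<noteq> 0\<close> show "inverse \<zeta> + \<zeta> = 1" by simp
qed

theorem theorem5p2:
  fixes \<zeta> :: complex and n :: nat
  assumes "\<zeta> ^ 6 = 1" and "\<forall>k\<in>{1..<6::nat}. \<zeta> ^ k \<noteq> 1"
    and "n \<ge> 1"
  shows "G n 1 (inverse \<zeta>) 1 \<zeta> =
           (\<Sum>\<alpha>\<in>compositions n. of_nat (Mot (length \<alpha>)) * hom_sym_comp \<alpha>)
       \<and> (\<Sum>\<alpha>\<in>compositions n. of_nat (Mot (length \<alpha>)) * (hom_sym_comp \<alpha> :: complex mseries)) =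
           (\<Sum>j = 1..n. of_nat (\<Sum>k = 0..n - j. ((n - j) choose k) * Mot (n - k)) * foulkes n (j - 1))"
proof
  let ?g = "tree_gf 1 (inverse \<zeta>) 1 \<zeta> UNIV" and ?K = "monomials_gf {0<..} - 1 :: complex mseries"
  have "(1 + ?g)\<^sup>2 = (1 + ?g + ?g\<^sup>2) * monomials_gf {0<..}"
    by (rule tree_gf_quadratic [OF primitive_sixth_root]) fact+
  \<comment> \<open>Subtracting \<open>1 + ?g + ?g^2\<close> from both sides leaves
    \<open>?g\<close> on the left.\<close>
  then have "?g = ?K * (1 + ?g + ?g\<^sup>2)"
    by (simp add: algebra_simps power2_eq_square)
  moreover have "mcoeff ?K {#} = 0" by (simp add: mcoeff_monomials_gf)
  ultimately have g: "mcoeff ?g M = (\<Sum>k = 1..size M. of_nat (Mot k) * mcoeff (?K ^ k) M)" for M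
    by (rule mcoeff_motzkin_solution)
  show "G n 1 (inverse \<zeta>) 1 \<zeta> = (\<Sum>\<alpha>\<in>compositions n. of_nat (Mot (length \<alpha>)) * hom_sym_comp \<alpha>)"
  proof (rule mseries_eqI)
    fix M
    show "mcoeff (G n 1 (inverse \<zeta>) 1 \<zeta>) M =
        mcoeff (\<Sum>\<alpha>\<in>compositions n. of_nat (Mot (length \<alpha>)) * hom_sym_comp \<alpha>) M"
    proof (cases "size M = n")
      case True
      then show ?thesis
        using \<open>n \<ge> 1\<close> by (simp only: mcoeff_G g mcoeff_motzkin_hom_sym simp_thms if_True)
    next
      case False
      then have "mcoeff (hom_sym_comp \<alpha>) M = (0 :: complex)" if "\<alpha> \<in> compositions n" for \<alpha>
        using that by (auto simp: compositions_def mcoeff_hom_sym_comp_eq_card)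
      with False \<open>n \<ge> 1\<close> show ?thesis by (simp add: mcoeff_G)
    qed
  qed
qed (rule sum_hom_sym_comp_eq_sum_foulkes [OF \<open>n \<ge> 1\<close>])

end
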